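(* Let $Y$ be a real random variable with Lebesgue density $f : \mathbb{R} \to [0,\infty)$, and let $g(x) := \sum_{z \in \mathbb{Z}} f(z+x) \in [0,\infty]$ for $x \in \mathbb{R}$. Suppose that $\mathrm{TV}(f) < \infty$. Then $g$ is real-valued (i.e. $g(x) < \infty$ for every $x \in \mathbb{R}$), and $$\mathrm{TV}(g, [0,1]) \le \mathrm{TV}(f) \quad\text{and}\quad \mathrm{R}(g) \le \mathrm{TV}(f)/2 .$$
   Context: For an interval $\mathbb{J} \subset \mathbb{R}$ and a function $h : \mathbb{J} \to \mathbb{R}$, the total variation of $h$ on $\mathbb{J}$ is $$\mathrm{TV}(h,\mathbb{J}) := \sup\Bigl\{ \sum_{i=1}^m |h(t_i) - h(t_{i-1})| : m \in \mathbb{N};\ t_0 < t_1 < \cdots < t_m;\ t_0,\ldots,t_m \in \mathbb{J} \Bigr\},$$ and $\mathrm{TV}(h) := \mathrm{TV}(h,\mathbb{R})$. The function $g$ is periodic with period 1, and its restriction to $[0,1)$ is a density of the remainder $U := Y - \lfloor Y \rfloor$. The range of $g$ is $\mathrm{R}(g) := \sup_{x,y \in \mathbb{R}} |g(y) - g(x)|$. *)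

theory Defs
  imports "HOL-Probability.Probability"
begin

definition total_variation :: "(real \<Rightarrow> real) \<Rightarrow> real set \<Rightarrow> ennreal" where
  "total_variation h J =
     Sup {ennreal (\<Sum>i=1..m. \<bar>h (t i) - h (t (i - 1))\<bar>) | (m :: nat) (t :: nat \<Rightarrow> real).
            strict_mono_on {0..m} t \<and> t ` {0..m} \<subseteq> J}"

definition function_range :: "(real \<Rightarrow> real) \<Rightarrow> ennreal" where
  "function_range h = (SUP (x, y) \<in> UNIV. ennreal \<bar>h y - h x\<bar>)"

definition periodized :: "(real \<Rightarrow> real) \<Rightarrow> real \<Rightarrow> ennreal" where
  "periodized f x = (\<Sum>\<^sub>\<infinity>z::int. ennreal (f (of_int z + x)))"

end

theory Submission
  imports Defs
begin

text \<open>
  Let \<open>v x\<close> be the variation of \<open>f\<close> on \<open>(-\<infinity>, x]\<close>. Then \<open>\<bar>f b - f a\<bar> \<le> v b - v a\<close> for \<open>a \<le> b\<close>, so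
  bounds on sums of variations of \<open>f\<close> over disjoint intervals become telescoping sums of \<open>v\<close>.
  Comparing \<open>f (z + x)\<close> with the integral of \<open>f\<close> over \<open>[z + x, z + x + 1)\<close> gives
  \<open>g x \<le> 1 + TV f\<close>. On each interval \<open>[c, c + 1]\<close> the function
  \<open>W c x = (\<Sum>z. v (z + x) - v (z + c))\<close> dominates the increments of \<open>g\<close> and increases by at most
  \<open>TV f\<close>, which yields the bound on the variation of \<open>g\<close>. For \<open>x \<le> y \<le> x + 1\<close> the increments of
  \<open>g\<close> over \<open>[x, y]\<close> and \<open>[y, x + 1]\<close> are opposite by periodicity, and their absolute values sum to
  at most \<open>TV f\<close>, which yields the bound on the range.
\<close>

section \<open>Variation sums and a monotone majorant of the increments\<close>

lemma variation_sum_le_total_variation: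
  fixes t :: "nat \<Rightarrow> real"
  assumes "strict_mono_on {0..m} t" and "t ` {0..m} \<subseteq> J"
  shows "ennreal (\<Sum>i=1..m. \<bar>h (t i) - h (t (i - 1))\<bar>) \<le> total_variation h J"
  unfolding total_variation_def by (rule Sup_upper) (use assms in blast)

lemma strict_mono_on_extend:
  fixes t :: "nat \<Rightarrow> real"
  assumes t: "strict_mono_on {0..m} t" and "t m < b"
  shows "strict_mono_on {0..Suc m} (t(Suc m := b))"
proof (rule strict_mono_onI)
  fix r s :: nat
  assume rs: "r \<in> {0..Suc m}" "s \<in> {0..Suc m}" "r < s"
  show "(t(Suc m := b)) r < (t(Suc m := b)) s"
  proof (cases "s = Suc m")
    case True
    have "r \<le> m" using rs True by simp
    then have "t r \<le> t m"
      using strict_mono_onD[OF t, of r m] by (cases "r = m") (auto intro: less_imp_le)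
    then show ?thesis using True rs assms(2) by simp
  next
    case False
    then show ?thesis using rs strict_mono_onD[OF t, of r s] by simp
  qed
qed

lemma variation_sum_extend:
  fixes h :: "real \<Rightarrow> real" and t :: "nat \<Rightarrow> real"
  shows "(\<Sum>i=1..Suc m. \<bar>h ((t(Suc m := b)) i) - h ((t(Suc m := b)) (i - 1))\<bar>)
       = (\<Sum>i=1..m. \<bar>h (t i) - h (t (i - 1))\<bar>) + \<bar>h b - h (t m)\<bar>"
proof -
  have "(\<Sum>i=1..m. \<bar>h ((t(Suc m := b)) i) - h ((t(Suc m := b)) (i - 1))\<bar>)
      = (\<Sum>i=1..m. \<bar>h (t i) - h (t (i - 1))\<bar>)"
    by (rule sum.cong) auto
  then show ?thesis by simp
qed

text \<open>Take \<open>v x\<close> as the supremum of the variation sums over chains ending at or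
  before \<open>x\<close>. A chain ending at or before \<open>a\<close> can be prolonged through
  \<open>a\<close> to \<open>b\<close>, which adds \<open>\<bar>f b - f a\<bar>\<close> to its sum.
  Since \<open>v\<close> takes values between 0 and the total variation, its increments are bounded
  by the latter.\<close>

lemma finite_total_variation_majorant:
  fixes f :: "real \<Rightarrow> real"
  assumes fin: "total_variation f UNIV < \<infinity>"
  obtains v :: "real \<Rightarrow> real" where
    "\<And>a b. a \<le> b \<Longrightarrow> \<bar>f b - f a\<bar> \<le> v b - v a"
    "\<And>a b. v b - v a \<le> enn2real (total_variation f UNIV)"
proof -
  define V where "V = enn2real (total_variation f UNIV)"
  define s where "s m t = (\<Sum>i=1..m. \<bar>f (t i) - f (t (i - 1))\<bar>)" for m and t :: "nat \<Rightarrow> real"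
  define S where "S x = {s m t | m t. strict_mono_on {0..m} t \<and> t m \<le> x}" for x
  define v where "v x = Sup (S x)" for x
  have s_le: "s m t \<le> V" if "strict_mono_on {0..m} t" for m t
  proof -
    have "ennreal (s m t) \<le> ennreal V"
      using variation_sum_le_total_variation[OF that, of UNIV f] fin
      by (simp add: s_def V_def less_top)
    then show ?thesis by (simp add: V_def)
  qed
  have bdd: "bdd_above (S x)" for x
    using s_le by (intro bdd_aboveI[of _ V]) (auto simp: S_def)
  \<comment> \<open>The one-point chain, \<open>m = 0\<close>, has the empty sum. This makes
    \<open>S x\<close> nonempty, as the suprema require.\<close>
  have zero: "0 \<in> S x" for x
    unfolding S_def s_def
    by (rule CollectI, rule exI[of _ 0], rule exI[of _ "\<lambda>_. x"]) (auto intro: strict_mono_onI)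
  have v_nonneg: "0 \<le> v x" for x
    unfolding v_def by (rule cSup_upper[OF zero bdd])
  have v_le: "v x \<le> V" for x
  proof -
    have "S x \<noteq> {}" using zero by blast
    then show ?thesis
      unfolding v_def by (rule cSup_least) (use s_le in \<open>auto simp: S_def\<close>)
  qed
  have s_le_v: "s m t \<le> v x" if "strict_mono_on {0..m} t" "t m \<le> x" for m t x
    unfolding v_def by (rule cSup_upper[OF _ bdd]) (use that in \<open>auto simp: S_def\<close>)
  have append: "s m t + \<bar>f x - f (t m)\<bar> \<le> v x"
    if "strict_mono_on {0..m} t" "t m < x" for m t x
    using s_le_v[OF strict_mono_on_extend[OF that], of x] variation_sum_extend[of f t m x]
    by (simp add: s_def)
  have "\<bar>f b - f a\<bar> \<le> v b - v a" if "a \<le> b" for a b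
  proof (cases "a = b")
    case False
    then have ab: "a < b" using that by simp
    have "y \<le> v b - \<bar>f b - f a\<bar>" if y: "y \<in> S a" for y
    proof -
      obtain m t where y: "y = s m t" and t: "strict_mono_on {0..m} t" "t m \<le> a"
        using y by (auto simp: S_def)
      show ?thesis
      \<comment> \<open>Chains are strictly increasing, so \<open>a\<close> may be inserted before
        \<open>b\<close> only if the chain does not already end there.\<close>
      proof (cases "t m = a")
        case True
        then show ?thesis using append[OF t(1), of b] ab y by simp
      next
        case False
        then have "t m < a" using t by simp
        have "s (Suc m) (t(Suc m := a)) + \<bar>f b - f a\<bar> \<le> v b"
          using append[OF strict_mono_on_extend[OF t(1) \<open>t m < a\<close>], of b] ab by simp
        then show ?thesis
          using variation_sum_extend[of f t m a] y by (simp add: s_def)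
      qed
    qed
    then have "v a \<le> v b - \<bar>f b - f a\<bar>"
      unfolding v_def[of a] using zero by (intro cSup_least) auto
    then show ?thesis by simp
  qed simp
  moreover have "v b - v a \<le> V" for a b
    using v_nonneg[of a] v_le[of b] by simp
  ultimately show thesis using that unfolding V_def by blast
qed

section \<open>Sums over integer translates\<close>

text \<open>By monotonicity, replacing \<open>y\<close> by \<open>x + 1\<close> and \<open>F\<close>
  by a block of consecutive integers only increases the sum, which then telescopes to a single
  increment of \<open>v\<close>.\<close>

lemma sum_int_increments_le:
  fixes v :: "real \<Rightarrow> real"
  assumes mono: "\<And>a b. a \<le> b \<Longrightarrow> v a \<le> v b"
    and bound: "\<And>a b. v b - v a \<le> V"
    and "finite F" and "y \<le> x + 1"
  shows "(\<Sum>z\<in>F. v (of_int z + y) - v (of_int z + x)) \<le> V"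
proof -
  have telescope: "(\<Sum>z\<in>{a..<a + int n}. v (of_int z + x + 1) - v (of_int z + x))
      = v (of_int a + real n + x) - v (of_int a + x)" for a n
  proof (induction n)
    case (Suc n)
    have "{a..<a + int (Suc n)} = insert (a + int n) {a..<a + int n}" by auto
    then show ?case using Suc by (simp add: algebra_simps)
  qed simp
  obtain N where N: "F \<subseteq> {- int N..<- int N + int (2 * N)}"
  proof -
    have "bdd_above ((\<lambda>z. \<bar>z\<bar>) ` F)" using \<open>finite F\<close> by simp
    then obtain B where B: "\<And>z. z \<in> F \<Longrightarrow> \<bar>z\<bar> \<le> B" by (auto simp: bdd_above_def)
    have "F \<subseteq> {- int (nat (B + 1))..<- int (nat (B + 1)) + int (2 * nat (B + 1))}"
    proof
      fix z assume "z \<in> F"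
      from B[OF this] show "z \<in> {- int (nat (B + 1))..<- int (nat (B + 1)) + int (2 * nat (B + 1))}"
        by auto
    qed
    then show thesis by (rule that)
  qed
  have "(\<Sum>z\<in>F. v (of_int z + y) - v (of_int z + x))
      \<le> (\<Sum>z\<in>F. v (of_int z + x + 1) - v (of_int z + x))"
    using \<open>y \<le> x + 1\<close> by (intro sum_mono) (auto intro!: mono)
  also have "\<dots> \<le> (\<Sum>z\<in>{- int N..<- int N + int (2 * N)}. v (of_int z + x + 1) - v (of_int z + x))"
    by (rule sum_mono2) (use N mono in auto)
  also have "\<dots> \<le> V"
    unfolding telescope by (rule bound)
  finally show ?thesis .
qed

lemma summable_on_int_increments:
  fixes v :: "real \<Rightarrow> real"
  assumes "\<And>a b. a \<le> b \<Longrightarrow> v a \<le> v b" and "\<And>a b. v b - v a \<le> V"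
    and "x \<le> y" and "y \<le> x + 1"
  shows "(\<lambda>z::int. v (of_int z + y) - v (of_int z + x)) summable_on UNIV"
proof (rule nonneg_bdd_above_summable_on)
  show "0 \<le> v (of_int z + y) - v (of_int z + x)" for z :: int
    using assms(1)[of "of_int z + x" "of_int z + y"] assms(3) by simp
  show "bdd_above (sum (\<lambda>z::int. v (of_int z + y) - v (of_int z + x)) ` {F. F \<subseteq> UNIV \<and> finite F})"
    using sum_int_increments_le[of v, OF assms(1,2) _ assms(4)] by (intro bdd_aboveI[of _ V]) auto
qed

text \<open>On a unit cell, the value at the left endpoint exceeds \<open>f\<close> by at most the
  increment of \<open>v\<close> across the cell. Averaging over disjoint cells bounds every finite
  partial sum by the integral of \<open>f\<close> plus \<open>V\<close>.\<close>

lemma summable_on_int_translates: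
  fixes f v :: "real \<Rightarrow> real"
  assumes nonneg: "\<And>x. 0 \<le> f x"
    and meas [measurable]: "(\<lambda>x. ennreal (f x)) \<in> borel_measurable lborel"
    and int: "(\<integral>\<^sup>+x. ennreal (f x) \<partial>lborel) < \<infinity>"
    and v: "\<And>a b. a \<le> b \<Longrightarrow> \<bar>f b - f a\<bar> \<le> v b - v a"
    and bound: "\<And>a b. v b - v a \<le> V"
  shows "(\<lambda>z::int. f (of_int z + x)) summable_on UNIV"
proof (rule nonneg_bdd_above_summable_on)
  have mono: "v a \<le> v b" if "a \<le> b" for a b using v[OF that] by linarith
  define I where "I = enn2real (\<integral>\<^sup>+x. ennreal (f x) \<partial>lborel)"
  have I: "(\<integral>\<^sup>+x. ennreal (f x) \<partial>lborel) = ennreal I"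
    using int by (simp add: I_def less_top)
  have "0 \<le> I" by (simp add: I_def)
  have "0 \<le> V" using bound[of 0 0] by simp
  \<comment> \<open>Half-open cells are disjoint: \<open>floor (u - x)\<close> recovers the index of
    the cell containing \<open>u\<close>.\<close>
  define J where "J z = {of_int z + x..<of_int z + x + 1}" for z :: int
  have J [measurable]: "J z \<in> sets lborel" for z by (simp add: J_def)
  define \<Delta> where "\<Delta> z = v (of_int z + (x + 1)) - v (of_int z + x)" for z :: int
  have \<Delta>: "0 \<le> \<Delta> z" for z using mono by (simp add: \<Delta>_def)
  have disj: "disjoint_family_on J F" for F
  proof -
    have "z = floor (u - x)" if "u \<in> J z" for u z
      using that unfolding J_def by (intro sym[OF floor_unique]) auto
    then show ?thesis unfolding disjoint_family_on_def by blast
  qed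
  have cell: "ennreal (f (of_int z + x)) \<le> (\<integral>\<^sup>+u. ennreal (f u) * indicator (J z) u \<partial>lborel) + ennreal (\<Delta> z)" for z
  proof -
    have len: "emeasure lborel (J z) = 1" by (simp add: J_def)
    have "ennreal (f (of_int z + x)) = (\<integral>\<^sup>+u. ennreal (f (of_int z + x)) * indicator (J z) u \<partial>lborel)"
      by (simp add: nn_integral_cmult_indicator[OF J] len)
    also have "\<dots> \<le> (\<integral>\<^sup>+u. ennreal (f u) * indicator (J z) u + ennreal (\<Delta> z) * indicator (J z) u \<partial>lborel)"
    proof (rule nn_integral_mono)
      fix u
      have "f (of_int z + x) \<le> f u + \<Delta> z" if "u \<in> J z"
        using that v[of "of_int z + x" u] mono[of u "of_int z + (x + 1)"] by (auto simp: J_def \<Delta>_def)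
      then show "ennreal (f (of_int z + x)) * indicator (J z) u
          \<le> ennreal (f u) * indicator (J z) u + ennreal (\<Delta> z) * indicator (J z) u"
        using nonneg \<Delta> by (auto simp: indicator_def simp flip: ennreal_plus)
    qed
    also have "\<dots> = (\<integral>\<^sup>+u. ennreal (f u) * indicator (J z) u \<partial>lborel) + ennreal (\<Delta> z)"
      by (subst nn_integral_add) (simp_all add: nn_integral_cmult_indicator[OF J] len)
    finally show ?thesis .
  qed
  have "(\<Sum>z\<in>F. f (of_int z + x)) \<le> I + V" if "finite F" for F :: "int set"
  proof -
    have "ennreal (\<Sum>z\<in>F. f (of_int z + x)) = (\<Sum>z\<in>F. ennreal (f (of_int z + x)))"
      using nonneg by simp
    also have "\<dots> \<le> (\<Sum>z\<in>F. (\<integral>\<^sup>+u. ennreal (f u) * indicator (J z) u \<partial>lborel) + ennreal (\<Delta> z))"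
      by (rule sum_mono) (rule cell)
    also have "\<dots> = (\<integral>\<^sup>+u. (\<Sum>z\<in>F. ennreal (f u) * indicator (J z) u) \<partial>lborel) + ennreal (\<Sum>z\<in>F. \<Delta> z)"
      using \<Delta> by (simp add: sum.distrib nn_integral_sum)
    also have "\<dots> \<le> (\<integral>\<^sup>+u. ennreal (f u) \<partial>lborel) + ennreal V"
    proof (intro add_mono nn_integral_mono ennreal_leI)
      \<comment> \<open>By disjointness the indicators add up to the indicator of the union, which
        is at most 1.\<close>
      show "(\<Sum>z\<in>F. ennreal (f u) * indicator (J z) u) \<le> ennreal (f u)" for u
        unfolding sum_distrib_left[symmetric] indicator_UN_disjoint[OF that disj, symmetric]
        by (simp add: indicator_def)
      show "(\<Sum>z\<in>F. \<Delta> z) \<le> V"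
        unfolding \<Delta>_def by (rule sum_int_increments_le) (use mono bound that in auto)
    qed
    also have "\<dots> = ennreal (I + V)"
      using \<open>0 \<le> V\<close> \<open>0 \<le> I\<close> by (simp add: I)
    finally show ?thesis using \<open>0 \<le> V\<close> \<open>0 \<le> I\<close> by (simp del: ennreal_plus)
  qed
  then show "bdd_above (sum (\<lambda>z::int. f (of_int z + x)) ` {F. F \<subseteq> UNIV \<and> finite F})"
    by (intro bdd_aboveI[of _ "I + V"]) auto
qed (rule nonneg)

section \<open>The periodized function\<close>

lemma has_sum_diff:
  fixes f g :: "'a \<Rightarrow> real"
  assumes "(f has_sum a) A" and "(g has_sum b) A"
  shows "((\<lambda>x. f x - g x) has_sum (a - b)) A"
proof -
  have "((\<lambda>x. - g x) has_sum - b) A"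
    using assms(2) by (simp add: has_sum_uminus)
  from has_sum_add[OF assms(1) this] show ?thesis by simp
qed

text \<open>The finite partial sums agree under \<open>ennreal\<close>, and its continuity carries
  the real limit over.\<close>

lemma periodized_eq_ennreal:
  assumes nonneg: "\<And>x. 0 \<le> f x" and "(\<lambda>z::int. f (of_int z + x)) summable_on UNIV"
  shows "periodized f x = ennreal (\<Sum>\<^sub>\<infinity>z::int. f (of_int z + x))"
proof -
  have "sum (\<lambda>z::int. ennreal (f (of_int z + x))) = (\<lambda>F. ennreal (\<Sum>z\<in>F. f (of_int z + x)))"
    by (simp add: fun_eq_iff nonneg)
  then have "((\<lambda>z::int. ennreal (f (of_int z + x))) has_sum ennreal (\<Sum>\<^sub>\<infinity>z::int. f (of_int z + x))) UNIV"
    using tendsto_ennrealI[OF has_sum_infsum[OF assms(2), unfolded has_sum_def]]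
    unfolding has_sum_def by (simp add: nonneg)
  then show ?thesis unfolding periodized_def by (rule infsumI)
qed

lemma periodized_add_int: "periodized f (x + of_int n) = periodized f x"
  unfolding periodized_def
  by (rule infsum_reindex_bij_witness[of _ "\<lambda>z. z - n" "\<lambda>z. z + n"]) (auto simp: algebra_simps)

theorem theorem1:
  fixes M :: "'a measure" and Y :: "'a \<Rightarrow> real" and f :: "real \<Rightarrow> real"
  assumes "prob_space M"
    and "\<And>x. 0 \<le> f x"
    and "distributed M lborel Y (\<lambda>x. ennreal (f x))"
    and "total_variation f UNIV < \<infinity>"
  shows "(\<forall>x. periodized f x < \<infinity>) \<and>
         total_variation (\<lambda>x. enn2real (periodized f x)) {0..1} \<le> total_variation f UNIV \<and>
         function_range (\<lambda>x. enn2real (periodized f x)) \<le> total_variation f UNIV / 2"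
proof -
  interpret prob_space M by fact
  define V where "V = enn2real (total_variation f UNIV)"
  have V: "total_variation f UNIV = ennreal V" and "0 \<le> V"
    using assms(4) by (simp_all add: V_def less_top)
  obtain v where v: "\<And>a b. a \<le> b \<Longrightarrow> \<bar>f b - f a\<bar> \<le> v b - v a" and bound: "\<And>a b. v b - v a \<le> V"
    using finite_total_variation_majorant[OF assms(4)] unfolding V_def by blast
  have mono: "v a \<le> v b" if "a \<le> b" for a b using v[OF that] by linarith
  have meas: "(\<lambda>x. ennreal (f x)) \<in> borel_measurable lborel"
    using assms(3) by (rule distributed_borel_measurable)
  have "(\<integral>\<^sup>+x. ennreal (f x) \<partial>lborel) = (\<integral>\<^sup>+\<omega>. 1 \<partial>M)"
    using distributed_nn_integral[OF assms(3), of "\<lambda>_. 1"] by simp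
  then have int: "(\<integral>\<^sup>+x. ennreal (f x) \<partial>lborel) < \<infinity>"
    by (simp add: emeasure_space_1)
  have summable: "(\<lambda>z::int. f (of_int z + x)) summable_on UNIV" for x
    by (rule summable_on_int_translates[OF assms(2) meas int v bound])
  have per: "periodized f x = ennreal (\<Sum>\<^sub>\<infinity>z::int. f (of_int z + x))" for x
    by (rule periodized_eq_ennreal[of f, OF assms(2) summable])
  \<comment> \<open>By \<open>per\<close> every value is finite, so \<open>enn2real\<close> loses
    nothing here.\<close>
  define g where "g x = enn2real (periodized f x)" for x
  have g: "((\<lambda>z::int. f (of_int z + x)) has_sum g x) UNIV" for x
    using has_sum_infsum[OF summable[of x]] by (simp add: g_def per infsum_nonneg assms(2))
  have g_add_int: "g (x + of_int n) = g x" for x n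
    by (simp add: g_def periodized_add_int)
  \<comment> \<open>The base point \<open>c\<close> stays free: the variation bound uses 0, the
    range bound the left point \<open>x\<close>.\<close>
  define W where "W c x = (\<Sum>\<^sub>\<infinity>z::int. v (of_int z + x) - v (of_int z + c))" for c x
  have W: "((\<lambda>z::int. v (of_int z + x) - v (of_int z + c)) has_sum W c x) UNIV"
    if "c \<le> x" "x \<le> c + 1" for c x
    unfolding W_def by (rule has_sum_infsum, rule summable_on_int_increments[of v, OF mono bound that])
  have W_le: "W c x \<le> V" if "c \<le> x" "x \<le> c + 1" for c x
    by (rule has_sum_le_finite_sums[OF W[OF that]], rule sum_int_increments_le[of v, OF mono bound _ that(2)])
  have W_self: "W c c = 0" for c by (simp add: W_def)
  have g_diff: "\<bar>g b - g a\<bar> \<le> W c b - W c a" if "c \<le> a" "a \<le> b" "b \<le> c + 1" for a b c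
  proof -
    have "((\<lambda>z::int. f (of_int z + b) - f (of_int z + a)) has_sum (g b - g a)) UNIV"
      by (rule has_sum_diff[OF g g])
    moreover have "((\<lambda>z::int. (v (of_int z + b) - v (of_int z + c)) - (v (of_int z + a) - v (of_int z + c)))
        has_sum (W c b - W c a)) UNIV"
      by (rule has_sum_diff[OF W W]) (use that in auto)
    \<comment> \<open>The terms \<open>v (of_int z + c)\<close> cancel, leaving a termwise
      comparison of increments.\<close>
    ultimately show ?thesis
      unfolding real_norm_def[symmetric]
      by (rule norm_infsum_le) (use v that in simp)
  qed
  have "total_variation g {0..1} \<le> ennreal V"
    unfolding total_variation_def
  proof (rule Sup_least, clarify)
    fix m :: nat and t :: "nat \<Rightarrow> real"
    assume t: "strict_mono_on {0..m} t" "t ` {0..m} \<subseteq> {0..1}"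
    have t01: "0 \<le> t i \<and> t i \<le> 1" if "i \<le> m" for i using t(2) that by (auto simp: image_subset_iff)
    have "(\<Sum>i=1..m. \<bar>g (t i) - g (t (i - 1))\<bar>) \<le> (\<Sum>i=1..m. W 0 (t i) - W 0 (t (i - 1)))"
    proof (rule sum_mono)
      fix i assume i: "i \<in> {1..m}"
      then have "t (i - 1) < t i" by (intro strict_mono_onD[OF t(1)]) auto
      then show "\<bar>g (t i) - g (t (i - 1))\<bar> \<le> W 0 (t i) - W 0 (t (i - 1))"
        using t01[of i] t01[of "i - 1"] i by (intro g_diff) auto
    qed
    also have "\<dots> = W 0 (t m) - W 0 (t 0)"
      by (induction m) auto
    also have "\<dots> \<le> V"
      using W_le[of 0 "t m"] g_diff[of 0 0 "t 0"] t01[of 0] t01[of m] W_self[of 0] by auto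
    finally show "ennreal (\<Sum>i=1..m. \<bar>g (t i) - g (t (i - 1))\<bar>) \<le> ennreal V"
      by (rule ennreal_leI)
  qed
  moreover have "\<bar>g y - g x\<bar> \<le> V / 2" for x y
  proof -
    \<comment> \<open>\<open>b\<close> is the representative of \<open>y\<close> modulo 1 in the
      period starting at \<open>x\<close>.\<close>
    define b where "b = y - of_int \<lfloor>y - x\<rfloor>"
    have b: "x \<le> b" "b \<le> x + 1" unfolding b_def by linarith+
    have "g b = g y" using g_add_int[of b "\<lfloor>y - x\<rfloor>"] by (simp add: b_def)
    moreover have "g (x + 1) = g x" using g_add_int[of x 1] by simp
    \<comment> \<open>Both increments, over \<open>[x, b]\<close> and \<open>[b, x + 1]\<close>,
      have absolute value \<open>\<bar>g y - g x\<bar>\<close>. Adding their bounds gives twice this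
      value at most \<open>W x (x + 1)\<close>, hence at most \<open>V\<close>.\<close>
    ultimately show ?thesis
      using g_diff[of x x b] g_diff[of x b "x + 1"] b W_le[of x "x + 1"] W_self[of x]
      by (simp add: abs_minus_commute)
  qed
  then have "function_range g \<le> ennreal (V / 2)"
    unfolding function_range_def by (auto intro!: SUP_least ennreal_leI)
  then have "function_range g \<le> ennreal V / 2"
    using \<open>0 \<le> V\<close> by (simp add: ennreal_divide_numeral)
  ultimately show ?thesis
    unfolding g_def V by (simp add: per)
qed

end
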